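(* Let $\boldsymbol{\sigma}=(\sigma_n)_{n\ge0}$ be a sequence of morphisms $\sigma_n:\mathcal{A}_{n+1}\to\mathcal{A}_n^+$. Suppose that each $\sigma_n$ satisfies at least one of the following: (a) $\mathrm{rk}(M_{\sigma_n})=|\mathcal{A}_{n+1}|$; (b) $|\mathcal{A}_{n+1}|=2$; (c) $\sigma_n$ is left or right permutative, or rotationally conjugate to a left or right permutative morphism. Then $\boldsymbol{\sigma}$ is recognizable for aperiodic points, i.e., for every $n\ge0$, every aperiodic $y\in\mathcal{A}_n^{\mathbb{Z}}$ has at most one centered $\sigma_n$-representation in $X_{\boldsymbol{\sigma}}^{(n+1)}$.
   Context: Alphabets are finite. A morphism $\sigma:\mathcal{A}\to\mathcal{B}^+$ is given by a non-empty word $\sigma(a)$ for each letter $a$ and is extended by concatenation to $\mathcal{A}^*$ and $\mathcal{A}^{\mathbb{Z}}$ (with $\sigma(x_0)$ starting at index $0$ in $\sigma(x)$). Its incidence matrix $M_\sigma$ is the $|\mathcal{B}|\times|\mathcal{A}|$ matrix whose $(i,j)$ entry is the number of occurrences of $i$ in $\sigma(j)$. $T$ is the left shift. A point $y$ is periodic if $T^k(y)=y$ for some $k\ge1$, aperiodic otherwise. A $\sigma$-representation of $y\in\mathcal{B}^{\mathbb{Z}}$ is a pair $(k,x)$ with $k\in\mathbb{Z}$, $x\in\mathcal{A}^{\mathbb{Z}}$, $y=T^k\sigma(x)$; it is centered if $0\le k<|\sigma(x_0)|$, and it is in $X\subseteq\mathcal{A}^{\mathbb{Z}}$ if $x\in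 X$. $\sigma$ is left (right) permutative if the first (last) letters of $\sigma(a)$ and $\sigma(b)$ are different for all distinct letters $a,b$. Morphisms $\sigma,\tilde\sigma:\mathcal{A}\to\mathcal{B}^+$ are rotationally conjugate if there is $w\in\mathcal{B}^*$ such that $\sigma(a)w=w\tilde\sigma(a)$ for all $a\in\mathcal{A}$, or $w\sigma(a)=\tilde\sigma(a)w$ for all $a\in\mathcal{A}$. For a sequence $\boldsymbol{\sigma}$ as in the claim and $0\le n<N$, $\sigma_{[n,N)}=\sigma_n\circ\sigma_{n+1}\circ\cdots\circ\sigma_{N-1}$. The language $\mathcal{L}_{\boldsymbol{\sigma}}^{(n)}$ is the set of all $w\in\mathcal{A}_n^*$ that are subwords (factors) of $\sigma_{[n,N)}(a)$ for some $N>n$ and $a\in\mathcal{A}_N$; $X_{\boldsymbol{\sigma}}^{(n)}$ is the set of $x\in\mathcal{A}_n^{\mathbb{Z}}$ all of whose finite subwords belong to $\mathcal{L}_{\boldsymbol{\sigma}}^{(n)}$. *)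

theory Defs
  imports "Jordan_Normal_Form.DL_Rank" "HOL-Library.Sublist" "HOL-Library.Countable_Set"
begin

text \<open>
  An alphabet is a finite set of letters, a morphism is a function from letters to words of which
  only the values on its alphabet matter, and a two-sided sequence is a function on the integers.
\<close>

definition is_morphism :: "'a set \<Rightarrow> 'b set \<Rightarrow> ('a \<Rightarrow> 'b list) \<Rightarrow> bool" where
  "is_morphism A B \<sigma> \<longleftrightarrow> (\<forall>a\<in>A. \<sigma> a \<in> lists B \<and> \<sigma> a \<noteq> [])"

definition word_ext :: "('a \<Rightarrow> 'b list) \<Rightarrow> 'a list \<Rightarrow> 'b list" where
  "word_ext \<sigma> w = concat (map \<sigma> w)"

definition biseqs :: "'a set \<Rightarrow> (int \<Rightarrow> 'a) set" where
  "biseqs A = {x. \<forall>i. x i \<in> A}"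

text \<open>The index at which the block \<open>\<sigma> (x k)\<close> starts in the image of \<open>x\<close>; it is \<open>0\<close> for \<open>k = 0\<close>.\<close>

definition block_start :: "('a \<Rightarrow> 'b list) \<Rightarrow> (int \<Rightarrow> 'a) \<Rightarrow> int \<Rightarrow> int" where
  "block_start \<sigma> x k =
     (if 0 \<le> k then (\<Sum>i\<in>{0..<k}. int (length (\<sigma> (x i))))
      else - (\<Sum>i\<in>{k..<0}. int (length (\<sigma> (x i)))))"

definition biseq_ext :: "('a \<Rightarrow> 'b list) \<Rightarrow> (int \<Rightarrow> 'a) \<Rightarrow> int \<Rightarrow> 'b" where
  "biseq_ext \<sigma> x j =
     (let k = (THE k. block_start \<sigma> x k \<le> j \<and> j < block_start \<sigma> x (k + 1))
      in \<sigma> (x k) ! nat (j - block_start \<sigma> x k))"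

definition left_shift :: "(int \<Rightarrow> 'a) \<Rightarrow> int \<Rightarrow> 'a" where
  "left_shift x = (\<lambda>i. x (i + 1))"

text \<open>The integer power \<open>T\<^sup>k\<close> of the left shift.\<close>

definition shift_pow :: "int \<Rightarrow> (int \<Rightarrow> 'a) \<Rightarrow> int \<Rightarrow> 'a" where
  "shift_pow k x = (\<lambda>i. x (i + k))"

definition periodic_point :: "(int \<Rightarrow> 'a) \<Rightarrow> bool" where
  "periodic_point y \<longleftrightarrow> (\<exists>k\<ge>1. (left_shift ^^ k) y = y)"

definition aperiodic_point :: "(int \<Rightarrow> 'a) \<Rightarrow> bool" where
  "aperiodic_point y \<longleftrightarrow> \<not> periodic_point y"

text \<open>Rows and columns are numbered by the bijections \<open>from_nat_into B\<close> and \<open>from_nat_into A\<close>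
  on initial segments of the naturals; the rank does not depend on the numbering.\<close>

definition incidence_matrix :: "'a set \<Rightarrow> 'b set \<Rightarrow> ('a \<Rightarrow> 'b list) \<Rightarrow> real mat" where
  "incidence_matrix A B \<sigma> =
     mat (card B) (card A)
       (\<lambda>(i, j). real (count_list (\<sigma> (from_nat_into A j)) (from_nat_into B i)))"

definition incidence_rank :: "'a set \<Rightarrow> 'b set \<Rightarrow> ('a \<Rightarrow> 'b list) \<Rightarrow> nat" where
  "incidence_rank A B \<sigma> = vec_space.rank (card B) (incidence_matrix A B \<sigma>)"

definition left_permutative :: "'a set \<Rightarrow> ('a \<Rightarrow> 'b list) \<Rightarrow> bool" where
  "left_permutative A \<sigma> \<longleftrightarrow> (\<forall>a\<in>A. \<forall>b\<in>A. a \<noteq> b \<longrightarrow> hd (\<sigma> a) \<noteq> hd (\<sigma> b))"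

definition right_permutative :: "'a set \<Rightarrow> ('a \<Rightarrow> 'b list) \<Rightarrow> bool" where
  "right_permutative A \<sigma> \<longleftrightarrow> (\<forall>a\<in>A. \<forall>b\<in>A. a \<noteq> b \<longrightarrow> last (\<sigma> a) \<noteq> last (\<sigma> b))"

definition rotationally_conjugate ::
    "'a set \<Rightarrow> 'b set \<Rightarrow> ('a \<Rightarrow> 'b list) \<Rightarrow> ('a \<Rightarrow> 'b list) \<Rightarrow> bool" where
  "rotationally_conjugate A B \<sigma> \<tau> \<longleftrightarrow>
     (\<exists>w\<in>lists B. (\<forall>a\<in>A. \<sigma> a @ w = w @ \<tau> a) \<or> (\<forall>a\<in>A. w @ \<sigma> a = \<tau> a @ w))"

definition is_representation ::
    "'a set \<Rightarrow> ('a \<Rightarrow> 'b list) \<Rightarrow> (int \<Rightarrow> 'b) \<Rightarrow> int \<times> (int \<Rightarrow> 'a) \<Rightarrow> bool" where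
  "is_representation A \<sigma> y = (\<lambda>(k, x). x \<in> biseqs A \<and> y = shift_pow k (biseq_ext \<sigma> x))"

definition is_centered :: "('a \<Rightarrow> 'b list) \<Rightarrow> int \<times> (int \<Rightarrow> 'a) \<Rightarrow> bool" where
  "is_centered \<sigma> = (\<lambda>(k, x). 0 \<le> k \<and> k < int (length (\<sigma> (x 0))))"

text \<open>The word \<open>\<sigma>\<^sub>n (\<sigma>\<^sub>n\<^sub>+\<^sub>1 (\<dots> (\<sigma>\<^sub>N\<^sub>-\<^sub>1 (a))))\<close>.\<close>

definition comp_interval :: "(nat \<Rightarrow> 'a \<Rightarrow> 'a list) \<Rightarrow> nat \<Rightarrow> nat \<Rightarrow> 'a \<Rightarrow> 'a list" where
  "comp_interval \<sigma> n N a = foldr (\<lambda>i. word_ext (\<sigma> i)) [n..<N] [a]"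

definition seq_language :: "(nat \<Rightarrow> 'a set) \<Rightarrow> (nat \<Rightarrow> 'a \<Rightarrow> 'a list) \<Rightarrow> nat \<Rightarrow> 'a list set" where
  "seq_language A \<sigma> n =
     {w \<in> lists (A n). \<exists>N>n. \<exists>a\<in>A N. sublist w (comp_interval \<sigma> n N a)}"

definition seq_shift :: "(nat \<Rightarrow> 'a set) \<Rightarrow> (nat \<Rightarrow> 'a \<Rightarrow> 'a list) \<Rightarrow> nat \<Rightarrow> (int \<Rightarrow> 'a) set" where
  "seq_shift A \<sigma> n =
     {x \<in> biseqs (A n). \<forall>i l. map (\<lambda>j. x (i + int j)) [0..<l] \<in> seq_language A \<sigma> n}"

definition recognizable_aperiodic :: "(nat \<Rightarrow> 'a set) \<Rightarrow> (nat \<Rightarrow> 'a \<Rightarrow> 'a list) \<Rightarrow> bool" where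
  "recognizable_aperiodic A \<sigma> \<longleftrightarrow>
     (\<forall>n. \<forall>y\<in>biseqs (A n). aperiodic_point y \<longrightarrow>
        (\<exists>\<^sub>\<le>\<^sub>1 r. is_representation (A (Suc n)) (\<sigma> n) y r \<and> is_centered (\<sigma> n) r
              \<and> snd r \<in> seq_shift A \<sigma> (Suc n)))"


lemma shift_pow_of_nat: "shift_pow (int k) = left_shift ^^ k"
proof (induction k)
  case 0
  show ?case by (simp add: shift_pow_def fun_eq_iff)
next
  case (Suc k)
  have "shift_pow (int (Suc k)) x = left_shift (shift_pow (int k) x)" for x :: "int \<Rightarrow> 'a"
    by (simp add: shift_pow_def left_shift_def algebra_simps)
  then show ?case using Suc by (simp add: fun_eq_iff)
qed

lemma block_start_0 [simp]: "block_start \<sigma> x 0 = 0"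
  by (simp add: block_start_def)

lemma block_start_step: "block_start \<sigma> x (k + 1) = block_start \<sigma> x k + int (length (\<sigma> (x k)))"
proof (cases "0 \<le> k")
  case True
  then have "{0..<k + 1} = insert k {0..<k}" by auto
  with True show ?thesis by (simp add: block_start_def)
next
  case False
  then have "{k..<0} = insert k {k + 1..<0}" by auto
  with False show ?thesis by (cases "k = -1") (simp_all add: block_start_def)
qed

lemma block_start_mono:
  assumes "k \<le> l"
  shows "block_start \<sigma> x k \<le> block_start \<sigma> x l"
  using assms
proof (induction l rule: int_ge_induct)
  case (step i)
  then show ?case by (simp add: block_start_step)
qed simp

lemma biseq_ext_block:
  assumes "i < length (\<sigma> (x k))"
  shows "biseq_ext \<sigma> x (block_start \<sigma> x k + int i) = \<sigma> (x k) ! i"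
proof -
  let ?j = "block_start \<sigma> x k + int i"
  have "(THE l. block_start \<sigma> x l \<le> ?j \<and> ?j < block_start \<sigma> x (l + 1)) = k"
  proof (rule the_equality)
    show "block_start \<sigma> x k \<le> ?j \<and> ?j < block_start \<sigma> x (k + 1)"
      using assms by (simp add: block_start_step)
  next
    fix l assume l: "block_start \<sigma> x l \<le> ?j \<and> ?j < block_start \<sigma> x (l + 1)"
    have "\<not> l + 1 \<le> k"
      using l block_start_mono[of "l + 1" k \<sigma> x] by auto
    moreover have "\<not> k + 1 \<le> l"
      using l assms block_start_mono[of "k + 1" l \<sigma> x] by (auto simp: block_start_step)
    ultimately show "l = k" by linarith
  qed
  then show ?thesis by (simp add: biseq_ext_def)
qed

end

theory Submission
  imports Defs
begin

text \<open>
  Place a mark \<open>u\<^sub>a(p) = 1\<close> wherever a tile \<open>\<sigma>(a)\<close> starts at \<open>p\<close>. The positions of a letter \<open>b\<close> in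
  the tiled sequence are obtained from the \<open>u\<^sub>a\<close> by convolution with polynomials \<open>J\<^sub>b\<^sub>a(z)\<close>, the sum
  of \<open>z\<^sup>r\<close> over the occurrences \<open>r\<close> of \<open>b\<close> in \<open>\<sigma>(a)\<close>. Here \<open>J(1)\<close> is the incidence matrix and
  \<open>J(0)\<close> records first letters, so \<open>J\<close> has full column rank over the rational functions both when
  the incidence matrix has full rank and when \<open>\<sigma>\<close> is left permutative. In that case the difference
  \<open>D\<close> of the marks of two tilings of the same sequence satisfies a scalar linear recurrence; being
  finite valued, \<open>D\<close> is periodic. If the tilings have a common cut, exchanging their right halves
  gives a difference that vanishes on a half line, hence everywhere, and the tilings agree.
  Otherwise all tiles are visible in \<open>D\<close>, so the tilings and the sequence are periodic.

  Right permutative morphisms are handled by reversal and conjugate ones by a shift. Two words that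
  do not commute are conjugate to words with different first letters; two that commute are powers
  of a common word and produce only periodic sequences.
\<close>

section \<open>Tilings and representations\<close>

text \<open>Tiles are recorded by absolute position and letter, without numbering. This forgets
  which tile has index 0, a choice that centering fixes, and lets reversal, shifting and splicing
  act as plain operations on sets.\<close>

definition tiling :: "'a set \<Rightarrow> ('a \<Rightarrow> 'b list) \<Rightarrow> (int \<Rightarrow> 'b) \<Rightarrow> (int \<times> 'a) set \<Rightarrow> bool" where
  "tiling A \<sigma> y T \<longleftrightarrow> T \<subseteq> UNIV \<times> A
     \<and> (\<forall>p. \<exists>!t. t \<in> T \<and> fst t \<le> p \<and> p < fst t + int (length (\<sigma> (snd t))))
     \<and> (\<forall>s a r. (s, a) \<in> T \<longrightarrow> r < length (\<sigma> a) \<longrightarrow> y (s + int r) = \<sigma> a ! r)"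

text \<open>A property of a single morphism, over all tilings of an aperiodic sequence. In this form
  it passes through reversal and conjugation with no language to carry along.\<close>

definition fully_recognizable :: "'a set \<Rightarrow> ('a \<Rightarrow> 'b list) \<Rightarrow> bool" where
  "fully_recognizable A \<sigma> \<longleftrightarrow>
     (\<forall>y T T'. aperiodic_point y \<longrightarrow> tiling A \<sigma> y T \<longrightarrow> tiling A \<sigma> y T' \<longrightarrow> T = T')"

lemma periodic_pointI:
  assumes "1 \<le> k" and "\<And>p. y (p + int k) = y p"
  shows "periodic_point y"
  unfolding periodic_point_def shift_pow_of_nat[symmetric]
  using assms by (auto simp: shift_pow_def fun_eq_iff)

lemma periodic_pointE:
  assumes "periodic_point y"
  obtains k :: nat where "1 \<le> k" and "\<And>p. y (p + int k) = y p"
  using assms unfolding periodic_point_def shift_pow_of_nat[symmetric]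
  by (auto simp: shift_pow_def fun_eq_iff)

lemma tilingD:
  assumes "tiling A \<sigma> y T"
  shows "(s, a) \<in> T \<Longrightarrow> a \<in> A"
    and "(s, a) \<in> T \<Longrightarrow> r < length (\<sigma> a) \<Longrightarrow> y (s + int r) = \<sigma> a ! r"
  using assms by (auto simp: tiling_def)

lemma tiling_unique:
  assumes "tiling A \<sigma> y T" "(s, a) \<in> T" "(s', a') \<in> T"
    and "s \<le> p" "p < s + int (length (\<sigma> a))" "s' \<le> p" "p < s' + int (length (\<sigma> a'))"
  shows "s = s'" and "a = a'"
proof -
  have "\<exists>!t. t \<in> T \<and> fst t \<le> p \<and> p < fst t + int (length (\<sigma> (snd t)))"
    using assms(1) by (auto simp: tiling_def)
  then have "(s, a) = (s', a')" using assms(2-) by (metis fst_conv snd_conv)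
  then show "s = s'" "a = a'" by auto
qed

lemma tiling_cover:
  assumes "tiling A \<sigma> y T"
  obtains s a where "(s, a) \<in> T" "s \<le> p" "p < s + int (length (\<sigma> a))"
proof -
  have "\<exists>!t. t \<in> T \<and> fst t \<le> p \<and> p < fst t + int (length (\<sigma> (snd t)))"
    using assms by (auto simp: tiling_def)
  then show thesis using that by auto
qed

lemma tilingI:
  assumes "\<And>s a. (s, a) \<in> T \<Longrightarrow> a \<in> A"
    and "\<And>p. \<exists>s a. (s, a) \<in> T \<and> s \<le> p \<and> p < s + int (length (\<sigma> a))"
    and "\<And>s a s' a' p. (s, a) \<in> T \<Longrightarrow> (s', a') \<in> T \<Longrightarrow> s \<le> p \<Longrightarrow> p < s + int (length (\<sigma> a))
           \<Longrightarrow> s' \<le> p \<Longrightarrow> p < s' + int (length (\<sigma> a')) \<Longrightarrow> s = s' \<and> a = a'"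
    and "\<And>s a r. (s, a) \<in> T \<Longrightarrow> r < length (\<sigma> a) \<Longrightarrow> y (s + int r) = \<sigma> a ! r"
  shows "tiling A \<sigma> y T"
  unfolding tiling_def
proof (intro conjI allI impI)
  show "T \<subseteq> UNIV \<times> A" using assms(1) by auto
  fix p
  obtain s a where sa: "(s, a) \<in> T" "s \<le> p" "p < s + int (length (\<sigma> a))"
    using assms(2) by blast
  show "\<exists>!t. t \<in> T \<and> fst t \<le> p \<and> p < fst t + int (length (\<sigma> (snd t)))"
  proof (rule ex1I[of _ "(s, a)"])
    show "(s, a) \<in> T \<and> fst (s, a) \<le> p \<and> p < fst (s, a) + int (length (\<sigma> (snd (s, a))))"
      using sa by simp
    fix t assume "t \<in> T \<and> fst t \<le> p \<and> p < fst t + int (length (\<sigma> (snd t)))"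
    then show "t = (s, a)" using assms(3)[OF _ sa(1) _ _ sa(2,3), of "fst t" "snd t"] 
      by (simp add: prod_eq_iff)
  qed
qed (use assms(4) in auto)

lemma tiling_next:
  assumes T: "tiling A \<sigma> y T" and ne: "\<forall>a\<in>A. \<sigma> a \<noteq> []" and sa: "(s, a) \<in> T"
  obtains a' where "(s + int (length (\<sigma> a)), a') \<in> T"
proof -
  let ?e = "s + int (length (\<sigma> a))"
  obtain s' a' where t: "(s', a') \<in> T" "s' \<le> ?e" "?e < s' + int (length (\<sigma> a'))"
    using tiling_cover[OF T] by metis
  have "a \<in> A" using tilingD(1)[OF T sa] .
  then have pos: "0 < length (\<sigma> a)" using ne by auto
  \<comment> \<open>A tile that starts before \<open>?e\<close> and covers it also covers
    \<open>?e - 1\<close>, which already belongs to \<open>(s, a)\<close>.\<close>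
  have "s' = ?e"
  proof (rule ccontr)
    assume "s' \<noteq> ?e"
    then have "s = s'" "a = a'"
      using tiling_unique[OF T sa t(1), of "?e - 1"] t pos by auto
    then show False using t by simp
  qed
  then show thesis using that t by simp
qed

lemma block_start_cover:
  assumes ne: "\<And>i. \<sigma> (x i) \<noteq> []"
  shows "\<exists>i. block_start \<sigma> x i \<le> j \<and> j < block_start \<sigma> x (i + 1)"
proof (induction j rule: int_induct[where k = 0])
  case base
  have "block_start \<sigma> x 0 \<le> 0 \<and> 0 < block_start \<sigma> x (0 + 1)"
    unfolding block_start_step using ne by simp
  then show ?case by blast
next
  case (step1 j)
  then obtain i where i: "block_start \<sigma> x i \<le> j" "j < block_start \<sigma> x (i + 1)" by blast
  have "0 < length (\<sigma> (x (i + 1)))" using ne by simp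
  then have "block_start \<sigma> x (i + 1) < block_start \<sigma> x (i + 1 + 1)"
    using block_start_step[of \<sigma> x "i + 1"] by linarith
  with i show ?case by (cases "j + 1 < block_start \<sigma> x (i + 1)") (force intro: exI[of _ i] exI[of _ "i + 1"])+
next
  case (step2 j)
  then obtain i where i: "block_start \<sigma> x i \<le> j" "j < block_start \<sigma> x (i + 1)" by blast
  have "0 < length (\<sigma> (x (i - 1)))" using ne by simp
  then have "block_start \<sigma> x (i - 1) < block_start \<sigma> x i"
    using block_start_step[of \<sigma> x "i - 1"] by simp
  with i show ?case by (cases "block_start \<sigma> x i \<le> j - 1") (force intro: exI[of _ i] exI[of _ "i - 1"])+
qed

lemma block_start_cover_unique:
  assumes "block_start \<sigma> x i \<le> j" "j < block_start \<sigma> x (i + 1)"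
    and "block_start \<sigma> x l \<le> j" "j < block_start \<sigma> x (l + 1)"
  shows "i = l"
  using assms block_start_mono[of "l + 1" i \<sigma> x] block_start_mono[of "i + 1" l \<sigma> x] by linarith

lemma representation_tiling:
  assumes ne: "\<forall>a\<in>A. \<sigma> a \<noteq> []" and rep: "is_representation A \<sigma> y (k, x)"
  shows "tiling A \<sigma> y (range (\<lambda>i. (block_start \<sigma> x i - k, x i)))"
proof (rule tilingI)
  have x: "\<And>i. x i \<in> A" and y: "\<And>j. y j = biseq_ext \<sigma> x (j + k)"
    using rep by (auto simp: is_representation_def biseqs_def shift_pow_def)
  fix p
  obtain i where "block_start \<sigma> x i \<le> p + k" "p + k < block_start \<sigma> x (i + 1)"
    using block_start_cover[of \<sigma> x] ne x by blast
  then show "\<exists>s a. (s, a) \<in> range (\<lambda>i. (block_start \<sigma> x i - k, x i)) \<and> s \<le> p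
      \<and> p < s + int (length (\<sigma> a))"
    by (intro exI[of _ "block_start \<sigma> x i - k"] exI[of _ "x i"]) (auto simp: block_start_step)
next
  fix s a s' a' p
  assume "(s, a) \<in> range (\<lambda>i. (block_start \<sigma> x i - k, x i))"
    and "(s', a') \<in> range (\<lambda>i. (block_start \<sigma> x i - k, x i))"
    and p: "s \<le> p" "p < s + int (length (\<sigma> a))" "s' \<le> p" "p < s' + int (length (\<sigma> a'))"
  then obtain i l where il: "s = block_start \<sigma> x i - k" "a = x i"
      "s' = block_start \<sigma> x l - k" "a' = x l" by auto
  have "i = l"
    using p block_start_cover_unique[of \<sigma> x i "p + k" l] by (simp add: il block_start_step)
  then show "s = s' \<and> a = a'" by (simp add: il)
next
  fix s a r
  assume "(s, a) \<in> range (\<lambda>i. (block_start \<sigma> x i - k, x i))" and r: "r < length (\<sigma> a)"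
  then obtain i where i: "s = block_start \<sigma> x i - k" "a = x i" by auto
  then show "y (s + int r) = \<sigma> a ! r"
    using rep r biseq_ext_block[of r \<sigma> x i]
    by (simp add: is_representation_def shift_pow_def)
qed (use rep in \<open>auto simp: is_representation_def biseqs_def\<close>)

text \<open>Centered means that the tile with index 0 covers position 0. Only one tile does, so both
  numberings start at the same tile and \<open>k = k'\<close>. Neighbours then agree by induction:
  to the right the next start is known, to the left the tile is the one covering the position just
  before the current start.\<close>

lemma centered_representation_determined_by_tiling:
  assumes ne: "\<forall>a\<in>A. \<sigma> a \<noteq> []"
    and rep: "is_representation A \<sigma> y (k, x)" and c: "is_centered \<sigma> (k, x)"
    and rep': "is_representation A \<sigma> y (k', x')" and c': "is_centered \<sigma> (k', x')"
    and eq: "range (\<lambda>i. (block_start \<sigma> x i - k, x i)) = range (\<lambda>i. (block_start \<sigma> x' i - k', x' i))"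
  shows "(k, x) = (k', x')"
proof -
  let ?b = "block_start \<sigma> x" and ?b' = "block_start \<sigma> x'"
  define T where "T = range (\<lambda>i. (?b i - k, x i))"
  have T: "tiling A \<sigma> y T" unfolding T_def by (rule representation_tiling[OF ne rep])
  have mem: "(?b i - k, x i) \<in> T" "(?b' i - k', x' i) \<in> T" for i
    unfolding T_def by (rule rangeI) (unfold eq, rule rangeI)
  have pos: "0 < length (\<sigma> (x i))" "0 < length (\<sigma> (x' i))" for i
    using ne rep rep' by (auto simp: is_representation_def biseqs_def)
  have k: "k = k'"
    using tiling_unique(1)[OF T mem(1)[of 0] mem(2)[of 0], of 0] c c'
    by (simp add: is_centered_def)
  have "?b i = ?b' i \<and> x i = x' i" for i
  proof (induction i rule: int_induct[where k = 0])
    case base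
    show ?case using tiling_unique(2)[OF T mem(1)[of 0] mem(2)[of 0], of 0] c c'
      by (simp add: is_centered_def)
  next
    case (step1 i)
    then have b: "?b (i + 1) = ?b' (i + 1)" by (simp add: block_start_step)
    then show ?case
      using tiling_unique(2)[OF T mem(1)[of "i + 1"] mem(2)[of "i + 1"], of "?b (i + 1) - k"]
        pos[of "i + 1"] k by simp
  next
    case (step2 i)
    have b: "?b i = ?b (i - 1) + int (length (\<sigma> (x (i - 1))))"
        "?b' i = ?b' (i - 1) + int (length (\<sigma> (x' (i - 1))))"
      using block_start_step[of \<sigma> x "i - 1"] block_start_step[of \<sigma> x' "i - 1"] by simp_all
    have "?b (i - 1) - k \<le> ?b i - k - 1" "?b i - k - 1 < ?b (i - 1) - k + int (length (\<sigma> (x (i - 1))))"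
        "?b' (i - 1) - k' \<le> ?b i - k - 1" "?b i - k - 1 < ?b' (i - 1) - k' + int (length (\<sigma> (x' (i - 1))))"
      using b pos[of "i - 1"] k step2 by linarith+
    from tiling_unique[OF T mem(1)[of "i - 1"] mem(2)[of "i - 1"] this] show ?case
      using k by simp
  qed
  then show ?thesis using k by auto
qed

lemma fully_recognizable_representation:
  assumes ne: "\<forall>a\<in>A. \<sigma> a \<noteq> []" and "fully_recognizable A \<sigma>" and "aperiodic_point y"
    and "is_representation A \<sigma> y r" "is_centered \<sigma> r"
    and "is_representation A \<sigma> y r'" "is_centered \<sigma> r'"
  shows "r = r'"
proof -
  obtain k x k' x' where r: "r = (k, x)" "r' = (k', x')" by (metis surj_pair)
  note reps = assms(4-7)[unfolded r]
  have "range (\<lambda>i. (block_start \<sigma> x i - k, x i)) = range (\<lambda>i. (block_start \<sigma> x' i - k', x' i))"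
    using assms(2,3) representation_tiling[OF ne reps(1)] representation_tiling[OF ne reps(3)]
    by (auto simp: fully_recognizable_def)
  from centered_representation_determined_by_tiling[OF ne reps this] show ?thesis by (simp add: r)
qed

section \<open>Reversal and rotational conjugacy\<close>

text \<open>A tile occupies s, ..., s + len - 1. Under p -> -p its last position becomes the first
  one, at 1 - s - len.\<close>

definition reflect_tile :: "('a \<Rightarrow> 'b list) \<Rightarrow> int \<times> 'a \<Rightarrow> int \<times> 'a" where
  "reflect_tile \<sigma> = (\<lambda>(s, a). (1 - s - int (length (\<sigma> a)), a))"

lemma inj_reflect_tile: "inj (reflect_tile \<sigma>)"
  by (auto simp: inj_def reflect_tile_def)

lemma tiling_rev:
  assumes T: "tiling A \<sigma> y T"
  shows "tiling A (\<lambda>a. rev (\<sigma> a)) (\<lambda>p. y (- p)) (reflect_tile \<sigma> ` T)"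
proof (rule tilingI)
  fix p
  obtain s a where "(s, a) \<in> T" "s \<le> - p" "- p < s + int (length (\<sigma> a))"
    using tiling_cover[OF T] by metis
  then show "\<exists>s a. (s, a) \<in> reflect_tile \<sigma> ` T \<and> s \<le> p \<and> p < s + int (length (rev (\<sigma> a)))"
    by (intro exI[of _ "1 - s - int (length (\<sigma> a))"] exI[of _ a])
      (auto simp: reflect_tile_def image_iff intro!: bexI[of _ "(s, a)"])
next
  fix s a s' a' p
  assume "(s, a) \<in> reflect_tile \<sigma> ` T" "(s', a') \<in> reflect_tile \<sigma> ` T"
    and p: "s \<le> p" "p < s + int (length (rev (\<sigma> a)))"
      "s' \<le> p" "p < s' + int (length (rev (\<sigma> a')))"
  then have t: "(1 - s - int (length (\<sigma> a)), a) \<in> T" "(1 - s' - int (length (\<sigma> a')), a') \<in> T"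
    by (auto simp: reflect_tile_def)
  show "s = s' \<and> a = a'" using tiling_unique[OF T t, of "- p"] p by auto
next
  fix s a r
  assume "(s, a) \<in> reflect_tile \<sigma> ` T" and r: "r < length (rev (\<sigma> a))"
  then have t: "(1 - s - int (length (\<sigma> a)), a) \<in> T" by (auto simp: reflect_tile_def)
  have "y (1 - s - int (length (\<sigma> a)) + int (length (\<sigma> a) - Suc r)) = \<sigma> a ! (length (\<sigma> a) - Suc r)"
    using tilingD(2)[OF T t, of "length (\<sigma> a) - Suc r"] r by simp
  then show "y (- (s + int r)) = rev (\<sigma> a) ! r"
    using r by (simp add: rev_nth of_nat_diff add.commute)
qed (use tilingD(1)[OF T] in \<open>auto simp: reflect_tile_def\<close>)

lemma aperiodic_point_reflect:
  assumes "aperiodic_point y"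
  shows "aperiodic_point (\<lambda>p. y (- p))"
proof -
  have False if per: "periodic_point (\<lambda>p. y (- p))"
  proof -
    obtain k :: nat where k: "1 \<le> k" "\<And>p. y (- (p + int k)) = y (- p)"
      using periodic_pointE[OF per] by metis
    have "y (p + int k) = y p" for p using k(2)[of "- p - int k"] by (simp add: add.commute)
    then show False using periodic_pointI[OF k(1)] assms by (auto simp: aperiodic_point_def)
  qed
  then show ?thesis by (auto simp: aperiodic_point_def)
qed

lemma fully_recognizable_rev:
  assumes "fully_recognizable A (\<lambda>a. rev (\<sigma> a))"
  shows "fully_recognizable A \<sigma>"
  unfolding fully_recognizable_def
proof (intro allI impI)
  fix y T T' assume "aperiodic_point y" "tiling A \<sigma> y T" "tiling A \<sigma> y T'"
  then have "reflect_tile \<sigma> ` T = reflect_tile \<sigma> ` T'"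
    using assms aperiodic_point_reflect[of y] tiling_rev
    unfolding fully_recognizable_def by blast
  then show "T = T'" by (simp add: inj_image_eq_iff[OF inj_reflect_tile])
qed

text \<open>Every cut of the tiling is followed by a copy of \<open>w\<close>. Hence from the start
  of a tile with letter \<open>a\<close> one reads \<open>\<sigma> a @ w = w @ \<tau> a\<close>, so
  \<open>\<tau> a\<close> stands \<open>length w\<close> further to the right.\<close>

lemma tiling_conjugate:
  assumes T: "tiling A \<sigma> y T" and ne: "\<forall>a\<in>A. \<sigma> a \<noteq> []"
    and conj: "\<And>a. a \<in> A \<Longrightarrow> \<sigma> a @ w = w @ \<tau> a"
  shows "tiling A \<tau> y ((\<lambda>(s, a). (s + int (length w), a)) ` T)"
proof -
  have len: "length (\<tau> a) = length (\<sigma> a)" if "a \<in> A" for a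
    using arg_cong[OF conj[OF that], of length] by simp
  \<comment> \<open>The word \<open>w\<close> is a prefix of \<open>\<sigma> a @ w\<close>. An index
    beyond the tile leads to a smaller index of \<open>w\<close> at the next cut, because tiles are
    non-empty.\<close>
  have w: "y (s + int i) = w ! i" if "i < length w" "(s, a) \<in> T" for i s a
    using that
  proof (induction i arbitrary: s a rule: less_induct)
    case (less i)
    have a: "a \<in> A" using tilingD(1)[OF T less.prems(2)] .
    then have pos: "0 < length (\<sigma> a)" using ne by simp
    from a have nth: "(\<sigma> a @ w) ! i = w ! i" using conj less.prems by (simp add: nth_append)
    show ?case
    proof (cases "i < length (\<sigma> a)")
      case True
      then show ?thesis using tilingD(2)[OF T less.prems(2) True] nth by (simp add: nth_append)
    next
      case False
      obtain a' where a': "(s + int (length (\<sigma> a)), a') \<in> T"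
        using tiling_next[OF T ne less.prems(2)] by blast
      have "y (s + int (length (\<sigma> a)) + int (i - length (\<sigma> a))) = w ! (i - length (\<sigma> a))"
        using pos False less.prems by (intro less.IH[OF _ _ a']) linarith+
      then show ?thesis using nth False by (simp add: nth_append of_nat_diff)
    qed
  qed
  show ?thesis
  proof (rule tilingI)
    fix p
    obtain s a where "(s, a) \<in> T" "s \<le> p - int (length w)"
        "p - int (length w) < s + int (length (\<sigma> a))"
      using tiling_cover[OF T] by metis
    then show "\<exists>s a. (s, a) \<in> (\<lambda>(s, a). (s + int (length w), a)) ` T \<and> s \<le> p
        \<and> p < s + int (length (\<tau> a))"
      using len[OF tilingD(1)[OF T]]
      by (intro exI[of _ "s + int (length w)"] exI[of _ a]) (auto simp: image_iff intro!: bexI[of _ "(s, a)"])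
  next
    fix s a s' a' p
    assume "(s, a) \<in> (\<lambda>(s, a). (s + int (length w), a)) ` T"
      and "(s', a') \<in> (\<lambda>(s, a). (s + int (length w), a)) ` T"
      and p: "s \<le> p" "p < s + int (length (\<tau> a))" "s' \<le> p" "p < s' + int (length (\<tau> a'))"
    then have t: "(s - int (length w), a) \<in> T" "(s' - int (length w), a') \<in> T" by auto
    show "s = s' \<and> a = a'"
      using tiling_unique[OF T t, of "p - int (length w)"] p len[OF tilingD(1)[OF T t(1)]]
        len[OF tilingD(1)[OF T t(2)]] by auto
  next
    fix s a r
    assume "(s, a) \<in> (\<lambda>(s, a). (s + int (length w), a)) ` T" and r: "r < length (\<tau> a)"
    then have t: "(s - int (length w), a) \<in> T" by auto
    have a: "a \<in> A" using tilingD(1)[OF T t] .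
    have nth: "\<tau> a ! r = (\<sigma> a @ w) ! (length w + r)" by (simp add: conj[OF a])
    show "y (s + int r) = \<tau> a ! r"
    \<comment> \<open>The letter is read either inside the old tile or in the copy of
      \<open>w\<close> after its end.\<close>
    proof (cases "length w + r < length (\<sigma> a)")
      case True
      then show ?thesis using tilingD(2)[OF T t True] nth by (simp add: nth_append)
    next
      case False
      obtain a' where a': "(s - int (length w) + int (length (\<sigma> a)), a') \<in> T"
        using tiling_next[OF T ne t] by blast
      have "length w + r - length (\<sigma> a) < length w" using r len[OF a] False by simp
      from w[OF this a'] show ?thesis
        using nth False by (simp add: nth_append of_nat_diff algebra_simps)
    qed
  qed (use tilingD(1)[OF T] in auto)
qed

lemma fully_recognizable_conjugate:
  fixes A :: "'a set"
  assumes "fully_recognizable A \<tau>" and "\<forall>a\<in>A. \<sigma> a \<noteq> []"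
    and "\<And>a. a \<in> A \<Longrightarrow> \<sigma> a @ w = w @ \<tau> a"
  shows "fully_recognizable A \<sigma>"
  unfolding fully_recognizable_def
proof (intro allI impI)
  fix y T T' assume "aperiodic_point y" "tiling A \<sigma> y T" "tiling A \<sigma> y T'"
  then have "(\<lambda>(s, a). (s + int (length w), a)) ` T = (\<lambda>(s, a). (s + int (length w), a)) ` T'"
    using assms(1) tiling_conjugate[OF _ assms(2,3)] unfolding fully_recognizable_def by blast
  moreover have "inj (\<lambda>(s, a :: 'a). (s + int (length w), a))" by (auto simp: inj_def)
  ultimately show "T = T'" by (simp add: inj_image_eq_iff)
qed

lemma fully_recognizable_rotationally_conjugate:
  assumes \<tau>: "fully_recognizable A \<tau>" and ne: "\<forall>a\<in>A. \<sigma> a \<noteq> []"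
    and conj: "rotationally_conjugate A B \<sigma> \<tau>"
  shows "fully_recognizable A \<sigma>"
proof -
  obtain w where "(\<forall>a\<in>A. \<sigma> a @ w = w @ \<tau> a) \<or> (\<forall>a\<in>A. w @ \<sigma> a = \<tau> a @ w)"
    using conj by (auto simp: rotationally_conjugate_def)
  then show ?thesis
  proof
    assume "\<forall>a\<in>A. \<sigma> a @ w = w @ \<tau> a"
    then show ?thesis using fully_recognizable_conjugate[OF \<tau> ne] by blast
  next
    assume w: "\<forall>a\<in>A. w @ \<sigma> a = \<tau> a @ w"
    \<comment> \<open>Reversing the second form of conjugacy gives the first form for the reversed
      morphisms, with \<open>rev w\<close>.\<close>
    have "fully_recognizable A (\<lambda>a. rev (\<tau> a))" by (rule fully_recognizable_rev) (simp add: \<tau>)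
    then have "fully_recognizable A (\<lambda>a. rev (\<sigma> a))"
    proof (rule fully_recognizable_conjugate)
      show "rev (\<sigma> a) @ rev w = rev w @ rev (\<tau> a)" if "a \<in> A" for a
        using w that by (metis rev_append)
    qed (use ne in auto)
    then show ?thesis by (rule fully_recognizable_rev)
  qed
qed

section \<open>Finite-valued linear recurrences\<close>

text \<open>States determine their left neighbours only, so a coincidence s(i) = s(j) yields the
  period j - i merely to the left. By pigeonhole there is a coincidence to the right of any given
  position, at distance at most the number N of states. That distance may vary, but it always
  divides N!, which is therefore a global period.\<close>

lemma finite_state_periodic:
  fixes s :: "int \<Rightarrow> 's"
  assumes fin: "finite (range s)" and det: "\<And>p q. s p = s q \<Longrightarrow> s (p - 1) = s (q - 1)"
  obtains k :: nat where "1 \<le> k" "\<And>p. s (p + int k) = s p"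
proof
  let ?N = "card (range s)"
  show "1 \<le> (fact ?N :: nat)" by simp
  have left: "s (p - int t) = s (q - int t)" if "s p = s q" for p q t
  proof (induction t)
    case (Suc t)
    from det[OF this] show ?case by (simp add: algebra_simps)
  qed (use that in simp)
  fix q
  let ?p = "q + int (fact ?N)"
  have "\<not> inj_on (\<lambda>i. s (?p + int i)) {..?N}"
  proof
    assume "inj_on (\<lambda>i. s (?p + int i)) {..?N}"
    from card_inj_on_le[OF this _ fin] show False by auto
  qed
  then obtain i j where ij: "i < j" "j \<le> ?N" "s (?p + int i) = s (?p + int j)"
    unfolding inj_on_def by (metis atMost_iff linorder_neqE_nat)
  define d where "d = j - i"
  \<comment> \<open>The coincidence lies at or beyond \<open>?p = q + N!\<close>, so all jumps by
    \<open>d\<close> from \<open>q\<close> up to \<open>?p\<close> stay in the region where the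
    period \<open>d\<close> is known.\<close>
  have step: "s (p + int d) = s p" if "p \<le> ?p" for p
    using left[OF ij(3), of "nat (?p - p) + i"] ij(1) that
    by (simp add: d_def of_nat_diff algebra_simps)
  have "d dvd fact ?N" using ij by (intro dvd_fact) (auto simp: d_def)
  then obtain m where m: "fact ?N = d * m" by (auto elim: dvdE)
  have "s (q + int (d * l)) = s q" if "l \<le> m" for l
    using that
  proof (induction l)
    case (Suc l)
    have "d * l \<le> d * m" using Suc.prems by simp
    then have "q + int (d * l) \<le> ?p" unfolding m by linarith
    from step[OF this] show ?case using Suc by (simp add: algebra_simps)
  qed simp
  from this[of m] show "s (q + int (fact ?N)) = s q" by (simp add: m)
qed

text \<open>The variable z acts as a delay by one position, so \<open>q\<close> acts by convolution.
  Products of polynomials become compositions (\<open>poly_act_mult\<close>), which turns polynomial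
  identities into recurrences.\<close>

definition poly_act :: "real poly \<Rightarrow> (int \<Rightarrow> real) \<Rightarrow> int \<Rightarrow> real" where
  "poly_act q f p = (\<Sum>i\<le>degree q. coeff q i * f (p - int i))"

lemma poly_act_eq_sum:
  assumes "degree q \<le> n"
  shows "poly_act q f p = (\<Sum>i\<le>n. coeff q i * f (p - int i))"
  unfolding poly_act_def using assms
  by (intro sum.mono_neutral_left) (auto simp: coeff_eq_0)

lemma poly_act_0 [simp]: "poly_act 0 f p = 0"
  by (simp add: poly_act_def)

lemma poly_act_add: "poly_act (q + r) f p = poly_act q f p + poly_act r f p"
proof -
  let ?n = "max (degree q) (degree r)"
  have "degree (q + r) \<le> ?n" by (simp add: degree_add_le)
  then show ?thesis
    by (simp add: poly_act_eq_sum[of _ ?n] sum.distrib algebra_simps)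
qed

lemma poly_act_sum: "poly_act (\<Sum>b\<in>B. q b) f p = (\<Sum>b\<in>B. poly_act (q b) f p)"
  by (induction B rule: infinite_finite_induct) (auto simp: poly_act_add)

lemma poly_act_smult: "poly_act (Polynomial.smult c q) f p = c * poly_act q f p"
  by (simp add: poly_act_eq_sum[of _ "degree q"] sum_distrib_left mult.assoc)

lemma poly_act_pCons: "poly_act (pCons c q) f p = c * f p + poly_act q f (p - 1)"
proof -
  have deg: "degree (pCons c q) \<le> Suc (degree q)" by (simp add: degree_pCons_le)
  show ?thesis
    unfolding poly_act_eq_sum[OF deg] sum.atMost_Suc_shift
    by (simp add: poly_act_def algebra_simps)
qed

lemma poly_act_mult: "poly_act (q * r) f p = poly_act q (poly_act r f) p"
  by (induction q arbitrary: p) (auto simp: poly_act_add poly_act_smult poly_act_pCons)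

lemma poly_act_sum_right: "poly_act q (\<lambda>p. \<Sum>a\<in>A. f a p) p = (\<Sum>a\<in>A. poly_act q (f a) p)"
  unfolding poly_act_def by (simp add: sum_distrib_left sum.swap[of _ _ A])

lemma poly_act_diff_right: "poly_act q (\<lambda>p. f p - g p) p = poly_act q f p - poly_act q g p"
  unfolding poly_act_def by (simp add: sum_subtractf algebra_simps)

lemma poly_act_leading:
  "poly_act q f p = lead_coeff q * f (p - int (degree q)) + (\<Sum>i<degree q. coeff q i * f (p - int i))"
  unfolding poly_act_def lessThan_Suc_atMost[symmetric] by simp

text \<open>The state at p is the window of values at p, ..., p - deg q, for all letters at once.
  The recurrence is solved for its leftmost value, since the leading coefficient is nonzero whereas
  the constant one may vanish; hence states determine each other leftwards.\<close>

lemma finite_valued_recurrence_periodic: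
  fixes D :: "'a \<Rightarrow> int \<Rightarrow> real"
  assumes A: "finite A" and V: "finite V" "\<And>a p. a \<in> A \<Longrightarrow> D a p \<in> V"
    and q: "q \<noteq> 0" and rec: "\<And>a p. a \<in> A \<Longrightarrow> poly_act q (D a) p = 0"
  obtains k :: nat where "1 \<le> k" "\<And>a p. a \<in> A \<Longrightarrow> D a (p + int k) = D a p"
proof -
  let ?d = "degree q"
  \<comment> \<open>The default 0 outside \<open>A\<close> leaves only finitely many possible
    functions.\<close>
  define F where "F p = (\<lambda>a. if a \<in> A then D a p else 0)" for p
  define s where "s p = map (\<lambda>i. F (p - int i)) [0..<Suc ?d]" for p
  have "range F \<subseteq> {f. \<forall>a. (a \<in> A \<longrightarrow> f a \<in> V) \<and> (a \<notin> A \<longrightarrow> f a = 0)}"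
    using V(2) by (auto simp: F_def)
  then have "finite (range F)"
    using finite_set_of_finite_funs[OF A V(1)] by (rule finite_subset)
  moreover have "range s \<subseteq> {xs. set xs \<subseteq> range F \<and> length xs = Suc ?d}"
    by (auto simp: s_def)
  ultimately have fin: "finite (range s)"
    using finite_lists_length_eq finite_subset by blast
  have s_eq: "s p = s p' \<longleftrightarrow> (\<forall>i\<le>?d. \<forall>a\<in>A. D a (p - int i) = D a (p' - int i))" for p p'
  proof -
    have "F i = F j \<longleftrightarrow> (\<forall>a\<in>A. D a i = D a j)" for i j
      by (auto simp: F_def fun_eq_iff)
    then show ?thesis unfolding s_def map_eq_conv by (auto simp del: upt_Suc)
  qed
  have last: "D a (p - int ?d) = - (\<Sum>i<?d. coeff q i * D a (p - int i)) / lead_coeff q"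
    if "a \<in> A" for a p
    using rec[OF that, of p] q unfolding poly_act_leading by (simp add: field_simps)
  have "s (p - 1) = s (p' - 1)" if eq: "s p = s p'" for p p'
    unfolding s_eq
  proof (intro allI impI ballI)
    have less: "D a (p - 1 - int i) = D a (p' - 1 - int i)" if "i < ?d" "a \<in> A" for i a
      using eq[unfolded s_eq, rule_format, of "Suc i" a] that by (simp add: algebra_simps)
    fix i a assume i: "i \<le> ?d" and a: "a \<in> A"
    show "D a (p - 1 - int i) = D a (p' - 1 - int i)"
    proof (cases "i = ?d")
      case True
      have "(\<Sum>i<?d. coeff q i * D a (p - 1 - int i)) = (\<Sum>i<?d. coeff q i * D a (p' - 1 - int i))"
        using less[OF _ a] by simp
      then show ?thesis unfolding True last[OF a] by simp
    qed (use i less[OF _ a] in simp)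
  qed
  from finite_state_periodic[of s, OF fin this] obtain k :: nat
    where k: "1 \<le> k" "\<And>p. s (p + int k) = s p" by metis
  show thesis
  proof (rule that[OF k(1)])
    fix a p assume "a \<in> A"
    then show "D a (p + int k) = D a p" using k(2)[of p, unfolded s_eq] by auto
  qed
qed

section \<open>Differences of tilings\<close>

text \<open>For \<open>w = \<sigma> a\<close> this is the entry J_ba(z). The coefficient list
  follows the word, so recursion on the word is recursion by \<open>pCons\<close>.\<close>

definition letter_poly :: "'b list \<Rightarrow> 'b \<Rightarrow> real poly" where
  "letter_poly w b = Poly (map (\<lambda>c. of_bool (c = b)) w)"

lemma letter_poly_simps [simp]:
  "letter_poly [] b = 0"
  "letter_poly (c # w) b = pCons (of_bool (c = b)) (letter_poly w b)"
  by (simp_all add: letter_poly_def)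

lemma poly_letter_poly_0: "w \<noteq> [] \<Longrightarrow> poly (letter_poly w b) 0 = of_bool (hd w = b)"
  by (cases w) auto

lemma poly_letter_poly_1: "poly (letter_poly w b) 1 = real (count_list w b)"
  by (induction w) auto

lemma poly_act_letter_poly:
  "poly_act (letter_poly w b) f p = (\<Sum>r<length w. of_bool (w ! r = b) * f (p - int r))"
proof (induction w arbitrary: p)
  case (Cons c w)
  show ?case
    unfolding letter_poly_simps poly_act_pCons Cons.IH length_Cons sum.lessThan_Suc_shift
    by (simp add: algebra_simps)
qed simp

text \<open>Exactly one tile covers p, so a single pair of letter and offset contributes. The
  right-hand side depends on \<open>y\<close> alone, which is why J annihilates the difference of
  two tilings of \<open>y\<close>.\<close>

lemma tiling_letter_sum:
  assumes A: "finite A" and T: "tiling A \<sigma> y T"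
  shows "(\<Sum>a\<in>A. poly_act (letter_poly (\<sigma> a) b) (\<lambda>s. of_bool ((s, a) \<in> T)) p) = of_bool (y p = b)"
proof -
  obtain s0 a0 where t: "(s0, a0) \<in> T" "s0 \<le> p" "p < s0 + int (length (\<sigma> a0))"
    using tiling_cover[OF T] by metis
  define r0 where "r0 = nat (p - s0)"
  have r0: "p = s0 + int r0" "r0 < length (\<sigma> a0)" using t by (auto simp: r0_def)
  have a0: "a0 \<in> A" using tilingD(1)[OF T t(1)] .
  have iff: "(p - int r, a) \<in> T \<longleftrightarrow> a = a0 \<and> r = r0" if "r < length (\<sigma> a)" for a r
  proof
    assume "(p - int r, a) \<in> T"
    from tiling_unique[OF T this t(1), of p] that t show "a = a0 \<and> r = r0" by (auto simp: r0_def)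
  qed (use t r0 in auto)
  have "(\<Sum>a\<in>A. poly_act (letter_poly (\<sigma> a) b) (\<lambda>s. of_bool ((s, a) \<in> T)) p)
      = (\<Sum>a\<in>A. \<Sum>r<length (\<sigma> a). if a = a0 then if r = r0 then of_bool (\<sigma> a0 ! r0 = b) else 0 else 0)"
    unfolding poly_act_letter_poly by (intro sum.cong refl) (auto simp: iff)
  also have "\<dots> = (\<Sum>a\<in>A. if a = a0
      then \<Sum>r<length (\<sigma> a0). if r = r0 then of_bool (\<sigma> a0 ! r0 = b) else 0 else 0)"
    by (intro sum.cong) auto
  also have "\<dots> = of_bool (\<sigma> a0 ! r0 = b)" using A a0 r0(2) by simp
  also have "\<sigma> a0 ! r0 = y p" using tilingD(2)[OF T t(1) r0(2)] r0(1) by simp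
  finally show ?thesis .
qed

text \<open>The Gram matrix of \<open>J(c)\<close> is invertible, so \<open>J(c)\<^sup>T J\<close> has a determinant that does not
  vanish at \<open>c\<close>, and Cramer's rule inverts it up to that determinant.\<close>

lemma left_inverse_up_to_factor:
  fixes J :: "'b \<Rightarrow> 'a \<Rightarrow> real poly"
  assumes A: "finite A" and B: "finite B"
    and inj: "\<forall>v. (\<forall>b\<in>B. (\<Sum>a\<in>A. poly (J b a) c * v a) = 0) \<longrightarrow> (\<forall>a\<in>A. v a = 0)"
  obtains q L where "q \<noteq> 0"
    "\<And>a a'. a \<in> A \<Longrightarrow> a' \<in> A \<Longrightarrow> (\<Sum>b\<in>B. L a b * J b a') = (if a = a' then q else 0)"
proof -
  define n where "n = card A"
  define e where "e = from_nat_into A"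
  have e: "bij_betw e {..<n} A"
    using bij_betw_from_nat_into_finite[OF A] by (simp add: e_def n_def)
  define g where "g = inv_into {..<n} e"
  have g: "g a < n" "e (g a) = a" if "a \<in> A" for a
    using that e bij_betw_inv_into_right[OF e that] bij_betwE[OF bij_betw_inv_into[OF e]]
    by (auto simp: g_def)
  define N where "N = mat n n (\<lambda>(i, j). \<Sum>b\<in>B. [:poly (J b (e i)) c:] * J b (e j))"
  have N: "N \<in> carrier_mat n n" by (simp add: N_def)
  interpret ev: comm_ring_hom "\<lambda>p :: real poly. poly p c" by unfold_locales auto
  let ?G = "map_mat (\<lambda>p. poly p c) N"
  have "det ?G \<noteq> 0"
  proof
    assume "det ?G = 0"
    moreover have G: "?G \<in> carrier_mat n n" using N by simp
    ultimately obtain v where v: "v \<in> carrier_vec n" "v \<noteq> 0\<^sub>v n" "?G *\<^sub>v v = 0\<^sub>v n"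
      using det_0_iff_vec_prod_zero[OF G] by auto
    \<comment> \<open>This is x = J(c) v. From J(c)^T x = 0 follows |x|^2 = v^T J(c)^T x = 0, so x =
      0 over the reals, and injectivity of J(c) kills v.\<close>
    define x where "x b = (\<Sum>j<n. poly (J b (e j)) c * v $ j)" for b
    have row: "(\<Sum>b\<in>B. poly (J b (e i)) c * x b) = 0" if "i < n" for i
    proof -
      have "0 = (?G *\<^sub>v v) $ i" using v that by simp
      also have "\<dots> = (\<Sum>j<n. (\<Sum>b\<in>B. poly (J b (e i)) c * poly (J b (e j)) c) * v $ j)"
        using that v(1) by (simp add: N_def scalar_prod_def poly_sum atLeast0LessThan)
      also have "\<dots> = (\<Sum>b\<in>B. poly (J b (e i)) c * x b)"
        unfolding x_def sum_distrib_left sum_distrib_right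
        by (subst sum.swap) (simp add: mult.assoc)
      finally show ?thesis by simp
    qed
    have "(\<Sum>b\<in>B. x b * x b) = (\<Sum>b\<in>B. \<Sum>i<n. v $ i * (poly (J b (e i)) c * x b))"
      by (simp add: x_def[of b for b] sum_distrib_right sum_distrib_left mult_ac)
    also have "\<dots> = (\<Sum>i<n. v $ i * (\<Sum>b\<in>B. poly (J b (e i)) c * x b))"
      by (subst sum.swap) (simp add: sum_distrib_left)
    also have "\<dots> = 0" using row by simp
    finally have "\<forall>b\<in>B. x b * x b = 0" using sum_nonneg_eq_0_iff[OF B, of "\<lambda>b. x b * x b"] by simp
    then have x0: "x b = 0" if "b \<in> B" for b using that by simp
    have "v $ g a = 0" if a: "a \<in> A" for a
    proof (rule inj[rule_format, of "\<lambda>a. v $ g a", OF _ a])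
      fix b assume "b \<in> B"
      have "(\<Sum>a\<in>A. poly (J b a) c * v $ g a) = (\<Sum>j<n. poly (J b (e j)) c * v $ g (e j))"
        using sum.reindex_bij_betw[OF e, of "\<lambda>a. poly (J b a) c * v $ g a"] by simp
      also have "\<dots> = x b"
        unfolding x_def g_def using e
        by (intro sum.cong) (auto simp: bij_betw_inv_into_left[OF e])
      finally show "(\<Sum>a\<in>A. poly (J b a) c * v $ g a) = 0" using x0[OF \<open>b \<in> B\<close>] by simp
    qed
    then have "v $ i = 0" if "i < n" for i
      using that e bij_betw_inv_into_left[OF e, of i] bij_betwE[OF e]
      unfolding g_def by (metis lessThan_iff)
    then have "v = 0\<^sub>v n" using v(1) by (intro eq_vecI) auto
    then show False using v(2) by simp
  qed
  then have "det N \<noteq> 0" by (metis ev.hom_det poly_0)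
  \<comment> \<open>L = adj(N) J(c)^T, so that L J = adj(N) N = det(N) I.\<close>
  define L where "L a b = (\<Sum>i<n. adj_mat N $$ (g a, i) * [:poly (J b (e i)) c:])" for a b
  show thesis
  proof (rule that[OF \<open>det N \<noteq> 0\<close>])
    fix a a' assume a: "a \<in> A" and a': "a' \<in> A"
    have adj: "adj_mat N \<in> carrier_mat n n" "adj_mat N * N = det N \<cdot>\<^sub>m 1\<^sub>m n"
      using adj_mat[OF N] by auto
    have "(\<Sum>b\<in>B. L a b * J b a') = (\<Sum>i<n. adj_mat N $$ (g a, i) * (\<Sum>b\<in>B. [:poly (J b (e i)) c:] * J b a'))"
      unfolding L_def sum_distrib_left sum_distrib_right
      by (subst sum.swap) (simp only: mult.assoc)
    also have "\<dots> = (\<Sum>i<n. adj_mat N $$ (g a, i) * N $$ (i, g a'))"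
      using g[OF a'] by (intro sum.cong) (auto simp: N_def)
    also have "\<dots> = (adj_mat N * N) $$ (g a, g a')"
      using g[OF a] g[OF a'] adj(1) N by (simp add: scalar_prod_def atLeast0LessThan)
    also have "\<dots> = (if a = a' then det N else 0)"
      unfolding adj(2) using g[OF a] g[OF a'] by auto
    finally show "(\<Sum>b\<in>B. L a b * J b a') = (if a = a' then det N else 0)" .
  qed
qed

text \<open>Applying L to J D = 0 decouples the letters: the same nonzero \<open>q\<close>
  annihilates every component of D, whose values are -1, 0 and 1.\<close>

lemma tiling_difference_periodic:
  assumes A: "finite A" and B: "finite B"
    and inj: "\<forall>v. (\<forall>b\<in>B. (\<Sum>a\<in>A. poly (letter_poly (\<sigma> a) b) c * v a) = 0)
      \<longrightarrow> (\<forall>a\<in>A. v a = 0)"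
    and T: "tiling A \<sigma> y T" and T': "tiling A \<sigma> y T'"
  obtains k :: nat where "1 \<le> k"
    "\<And>a p. a \<in> A \<Longrightarrow> (of_bool ((p + int k, a) \<in> T) - of_bool ((p + int k, a) \<in> T') :: real)
       = of_bool ((p, a) \<in> T) - of_bool ((p, a) \<in> T')"
proof -
  define D where "D a p = (of_bool ((p, a) \<in> T) - of_bool ((p, a) \<in> T') :: real)" for a p
  let ?J = "\<lambda>b a. letter_poly (\<sigma> a) b"
  have JD: "(\<Sum>a\<in>A. poly_act (?J b a) (D a) p) = 0" for b p
    unfolding D_def poly_act_diff_right sum_subtractf tiling_letter_sum[OF A T]
      tiling_letter_sum[OF A T'] by simp
  obtain q L where q: "q \<noteq> 0" and L: "\<And>a a'. a \<in> A \<Longrightarrow> a' \<in> A \<Longrightarrow>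
      (\<Sum>b\<in>B. L a b * ?J b a') = (if a = a' then q else 0)"
    using left_inverse_up_to_factor[OF A B inj] by blast
  have rec: "poly_act q (D a) p = 0" if a: "a \<in> A" for a p
  proof -
    have "poly_act q (D a) p = (\<Sum>a'\<in>A. poly_act (if a = a' then q else 0) (D a') p)"
      using A a by (simp add: if_distrib[of "\<lambda>q. poly_act q _ _"] cong: if_cong)
    also have "\<dots> = (\<Sum>a'\<in>A. \<Sum>b\<in>B. poly_act (L a b) (poly_act (?J b a') (D a')) p)"
      using L[OF a, symmetric] by (intro sum.cong refl) (simp only: poly_act_mult poly_act_sum)
    also have "\<dots> = (\<Sum>b\<in>B. poly_act (L a b) (\<lambda>p. \<Sum>a'\<in>A. poly_act (?J b a') (D a') p) p)"
      unfolding poly_act_sum_right by (rule sum.swap)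
    also have "\<dots> = 0" unfolding JD by (simp add: poly_act_def)
    finally show ?thesis .
  qed
  have "D a p \<in> {-1, 0, 1}" if "a \<in> A" for a p by (auto simp: D_def)
  from finite_valued_recurrence_periodic[where D = D, OF A _ this q rec] obtain k :: nat
    where "1 \<le> k" "\<And>a p. a \<in> A \<Longrightarrow> D a (p + int k) = D a p" by (metis finite.simps)
  then show thesis using that unfolding D_def by blast
qed

text \<open>At a common cut no tile of either tiling straddles \<open>q\<close>, so the left part of
  one fits the right part of the other.\<close>

lemma tiling_splice:
  assumes ne: "\<forall>a\<in>A. \<sigma> a \<noteq> []" and T: "tiling A \<sigma> y T" and T': "tiling A \<sigma> y T'"
    and cut: "(q, a) \<in> T" and cut': "(q, a') \<in> T'"
  shows "tiling A \<sigma> y ({t \<in> T. fst t < q} \<union> {t \<in> T'. q \<le> fst t})"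
proof (rule tilingI)
  have no_cross: "\<not> (s < q \<and> q < s + int (length (\<sigma> b)))" if "(s, b) \<in> T" for s b
    using tiling_unique(1)[OF T that cut, of q] ne tilingD(1)[OF T cut] by auto
  have no_cross': "\<not> (s < q \<and> q < s + int (length (\<sigma> b)))" if "(s, b) \<in> T'" for s b
    using tiling_unique(1)[OF T' that cut', of q] ne tilingD(1)[OF T' cut'] by auto
  {
    fix p
    show "\<exists>s b. (s, b) \<in> {t \<in> T. fst t < q} \<union> {t \<in> T'. q \<le> fst t} \<and> s \<le> p
        \<and> p < s + int (length (\<sigma> b))"
    proof (cases "p < q")
      case True
      obtain s b where "(s, b) \<in> T" "s \<le> p" "p < s + int (length (\<sigma> b))"
        using tiling_cover[OF T] by metis
      with True show ?thesis by force
    next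
      case False
      obtain s b where t: "(s, b) \<in> T'" "s \<le> p" "p < s + int (length (\<sigma> b))"
        using tiling_cover[OF T'] by metis
      with False no_cross'[OF t(1)] have "q \<le> s" by linarith
      with t show ?thesis by force
    qed
  }
  fix s b s' b' p
  assume t: "(s, b) \<in> {t \<in> T. fst t < q} \<union> {t \<in> T'. q \<le> fst t}"
      "(s', b') \<in> {t \<in> T. fst t < q} \<union> {t \<in> T'. q \<le> fst t}"
    and p: "s \<le> p" "p < s + int (length (\<sigma> b))" "s' \<le> p" "p < s' + int (length (\<sigma> b'))"
  consider "(s, b) \<in> T" "(s', b') \<in> T" | "(s, b) \<in> T'" "(s', b') \<in> T'"
    | "(s, b) \<in> T" "s < q" "q \<le> s'" | "(s', b') \<in> T" "s' < q" "q \<le> s"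
    using t by auto
  then show "s = s' \<and> b = b'"
  proof cases
    case 1
    then show ?thesis using tiling_unique[OF T 1 p] by blast
  next
    case 2
    then show ?thesis using tiling_unique[OF T' 2 p] by blast
  next
    case 3
    then show ?thesis using no_cross[OF 3(1)] p by linarith
  next
    case 4
    then show ?thesis using no_cross[OF 4(1)] p by linarith
  qed
qed (use tilingD(1)[OF T] tilingD(1)[OF T'] tilingD(2)[OF T] tilingD(2)[OF T'] in auto)

lemma periodic_mult:
  fixes f :: "int \<Rightarrow> 'c"
  assumes "\<And>p. f (p + int k) = f p"
  shows "f (p + int (m * k)) = f p"
proof (induction m)
  case (Suc m)
  then show ?case using assms[of "p + int (m * k)"] by (simp add: algebra_simps)
qed simp

lemma fully_recognizable_if_injective_at_point:
  assumes A: "finite A" and B: "finite B" and ne: "\<forall>a\<in>A. \<sigma> a \<noteq> []"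
    and inj: "\<forall>v. (\<forall>b\<in>B. (\<Sum>a\<in>A. poly (letter_poly (\<sigma> a) b) c * v a) = 0)
      \<longrightarrow> (\<forall>a\<in>A. v a = 0)"
  shows "fully_recognizable A \<sigma>"
  unfolding fully_recognizable_def
proof (intro allI impI)
  fix y T T' assume ap: "aperiodic_point y" and T: "tiling A \<sigma> y T" and T': "tiling A \<sigma> y T'"
  \<comment> \<open>Two tilings that agree on a half line are equal: their difference is periodic
    and vanishes on that half line.\<close>
  have half: "U = U'" if U: "tiling A \<sigma> y U" and U': "tiling A \<sigma> y U'"
    and eq: "(\<forall>p a. p < q \<longrightarrow> ((p, a) \<in> U \<longleftrightarrow> (p, a) \<in> U'))
      \<or> (\<forall>p a. q \<le> p \<longrightarrow> ((p, a) \<in> U \<longleftrightarrow> (p, a) \<in> U'))" for U U' q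
  proof -
    define D where "D a p = (of_bool ((p, a) \<in> U) - of_bool ((p, a) \<in> U') :: real)" for a p
    obtain k :: nat where k: "1 \<le> k" "\<And>a p. a \<in> A \<Longrightarrow> D a (p + int k) = D a p"
      using tiling_difference_periodic[OF A B inj U U'] unfolding D_def by metis
    have D0: "D a p = 0" if a: "a \<in> A" for a p
    proof -
      \<comment> \<open>Large enough for p - mk and p + mk to lie on different sides of
        \<open>q\<close>, so one of them is in the half line of agreement.\<close>
      define m where "m = nat (\<bar>p - q\<bar> + 1)"
      have "m \<le> m * k" using k(1) by simp
      then have m: "\<bar>p - q\<bar> + 1 \<le> int (m * k)" unfolding m_def by linarith
      have "D a (p - int (m * k)) = D a p" "D a (p + int (m * k)) = D a p"
        using periodic_mult[of "D a" k "p - int (m * k)" m] periodic_mult[of "D a" k p m] k(2)[OF a]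
        by simp_all
      moreover have "D a (p - int (m * k)) = 0 \<or> D a (p + int (m * k)) = 0"
        using eq m by (auto simp: D_def)
      ultimately show ?thesis by auto
    qed
    have "(p, a) \<in> U \<longleftrightarrow> (p, a) \<in> U'" for p a
      using D0[of a p] tilingD(1)[OF U, of p a] tilingD(1)[OF U', of p a]
      by (auto simp: D_def split: if_splits)
    then show "U = U'" by auto
  qed
  show "T = T'"
  proof (cases "\<exists>q a a'. (q, a) \<in> T \<and> (q, a') \<in> T'")
    case True
    then obtain q a a' where cut: "(q, a) \<in> T" "(q, a') \<in> T'" by blast
    \<comment> \<open>The spliced tiling agrees with \<open>T\<close> left of \<open>q\<close>,
      hence equals \<open>T\<close>. So \<open>T\<close> and \<open>T'\<close> agree from
      \<open>q\<close> on, and \<open>half\<close> applies a second time.\<close>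
    have "T = {t \<in> T. fst t < q} \<union> {t \<in> T'. q \<le> fst t}"
      by (rule half[OF T tiling_splice[OF ne T T' cut], of q]) auto
    then have "(p, a) \<in> T \<longleftrightarrow> (p, a) \<in> T'" if "q \<le> p" for p a
      using that by (metis (no_types, lifting) UnE UnI2 fst_conv linorder_not_le mem_Collect_eq)
    then show ?thesis by (intro half[OF T T', of q]) blast
  next
    case no_cut: False
    obtain k :: nat where k: "1 \<le> k"
      "\<And>a p. a \<in> A \<Longrightarrow> (of_bool ((p + int k, a) \<in> T) - of_bool ((p + int k, a) \<in> T') :: real)
         = of_bool ((p, a) \<in> T) - of_bool ((p, a) \<in> T')"
      using tiling_difference_periodic[OF A B inj T T'] by metis
    \<comment> \<open>Without common cuts nothing cancels: the difference is 1 exactly at the tiles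
      of \<open>T\<close>, so its period moves tiles of \<open>T\<close> to tiles of
      \<open>T\<close>.\<close>
    have shift: "(p + int k, a) \<in> T" if "(p, a) \<in> T" for p a
      using k(2)[OF tilingD(1)[OF T that], of p] that no_cut
      by (cases "(p + int k, a) \<in> T"; cases "(p + int k, a) \<in> T'") auto
    have "y (p + int k) = y p" for p
    proof -
      obtain s a where t: "(s, a) \<in> T" "s \<le> p" "p < s + int (length (\<sigma> a))"
        using tiling_cover[OF T] by metis
      then have r: "nat (p - s) < length (\<sigma> a)" by simp
      show ?thesis
        using tilingD(2)[OF T t(1) r] tilingD(2)[OF T shift[OF t(1)] r] t(2) by (simp add: algebra_simps)
    qed
    then have "periodic_point y" by (rule periodic_pointI[OF k(1)])
    then show ?thesis using ap by (simp add: aperiodic_point_def)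
  qed
qed

section \<open>Recognizable classes of morphisms\<close>

text \<open>At c = 0 only first letters count. With \<open>B\<close> the set of first letters, J(0)
  is a permutation matrix.\<close>

lemma fully_recognizable_left_permutative:
  assumes A: "finite A" and ne: "\<forall>a\<in>A. \<sigma> a \<noteq> []" and perm: "left_permutative A \<sigma>"
  shows "fully_recognizable A \<sigma>"
proof (rule fully_recognizable_if_injective_at_point[where B = "(\<lambda>a. hd (\<sigma> a)) ` A" and c = 0])
  show "\<forall>v. (\<forall>b\<in>(\<lambda>a. hd (\<sigma> a)) ` A. (\<Sum>a\<in>A. poly (letter_poly (\<sigma> a) b) 0 * v a) = 0)
      \<longrightarrow> (\<forall>a\<in>A. v a = 0)"
  proof (intro allI impI ballI)
    fix v :: "'a \<Rightarrow> real" and a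
    assume 0: "\<forall>b\<in>(\<lambda>a. hd (\<sigma> a)) ` A. (\<Sum>a\<in>A. poly (letter_poly (\<sigma> a) b) 0 * v a) = 0"
      and a: "a \<in> A"
    have "(\<Sum>a'\<in>A. poly (letter_poly (\<sigma> a') (hd (\<sigma> a))) 0 * v a') = (\<Sum>a'\<in>A. if a' = a then v a else 0)"
      using perm a ne by (intro sum.cong) (auto simp: poly_letter_poly_0 left_permutative_def)
    also have "\<dots> = v a" using A a by simp
    finally show "v a = 0" using 0 a by simp
  qed
qed (use A ne in auto)

lemma fully_recognizable_right_permutative:
  assumes A: "finite A" and ne: "\<forall>a\<in>A. \<sigma> a \<noteq> []" and perm: "right_permutative A \<sigma>"
  shows "fully_recognizable A \<sigma>"
proof (rule fully_recognizable_rev, rule fully_recognizable_left_permutative[OF A])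
  show "left_permutative A (\<lambda>a. rev (\<sigma> a))"
    using perm by (simp add: left_permutative_def right_permutative_def hd_rev)
qed (use ne in auto)

text \<open>Linear independence is a property of the set of columns, in which equal columns would
  merge. Distinctness therefore comes first: the rank is the size of a maximal independent subset of
  the columns, so there are at least \<open>nc\<close> different ones.\<close>

lemma (in vec_space) full_column_rank_kernel:
  assumes M: "M \<in> carrier_mat n nc" and rank: "rank M = nc"
    and v: "v \<in> carrier_vec nc" "M *\<^sub>v v = 0\<^sub>v n"
  shows "v = 0\<^sub>v nc"
proof -
  obtain S where S: "maximal S (\<lambda>T. T \<subseteq> set (cols M) \<and> lin_indpt T)"
    using maximal_exists[of "(\<lambda>T. T \<subseteq> set (cols M) \<and> lin_indpt T)" "card (set (cols M))" "{}"]
    by (meson List.finite_set card_mono empty_iff empty_subsetI finite_lin_indpt2 rev_finite_subset)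
  then have "nc = card S" using rank_card_indpt[OF M S] rank by simp
  also have "\<dots> \<le> card (set (cols M))" using S by (simp add: card_mono maximal_def)
  finally have "length (cols M) \<le> card (set (cols M))" using M by simp
  then have dist: "distinct (cols M)"
    by (intro card_distinct le_antisym card_length)
  show ?thesis
    using full_rank_lin_indpt[OF M rank dist] lin_depI[OF M v(1) _ v(2) dist] by blast
qed

text \<open>At c = 1 the matrix J(1) is the incidence matrix. The proof transports its trivial
  kernel from numbered coordinates to letters.\<close>

lemma fully_recognizable_full_rank:
  assumes A: "finite A" and B: "finite B" and ne: "\<forall>a\<in>A. \<sigma> a \<noteq> []"
    and rank: "incidence_rank A B \<sigma> = card A"
  shows "fully_recognizable A \<sigma>"
proof (rule fully_recognizable_if_injective_at_point[OF A B ne, where c = 1], intro allI impI ballI)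
  let ?M = "incidence_matrix A B \<sigma>"
  have M: "?M \<in> carrier_mat (card B) (card A)" by (simp add: incidence_matrix_def)
  have eA: "bij_betw (from_nat_into A) {..<card A} A" and eB: "bij_betw (from_nat_into B) {..<card B} B"
    using bij_betw_from_nat_into_finite A B by auto
  fix v :: "'a \<Rightarrow> real" and a
  assume 0: "\<forall>b\<in>B. (\<Sum>a\<in>A. poly (letter_poly (\<sigma> a) b) 1 * v a) = 0" and a: "a \<in> A"
  let ?v = "vec (card A) (\<lambda>j. v (from_nat_into A j))"
  have "?M *\<^sub>v ?v = 0\<^sub>v (card B)"
  proof (rule eq_vecI)
    fix i assume "i < dim_vec (0\<^sub>v (card B) :: real vec)"
    then have i: "i < card B" by simp
    have "(?M *\<^sub>v ?v) $ i = (\<Sum>j<card A. real (count_list (\<sigma> (from_nat_into A j)) (from_nat_into B i))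
        * v (from_nat_into A j))"
      using i by (simp add: incidence_matrix_def scalar_prod_def atLeast0LessThan)
    also have "\<dots> = (\<Sum>a\<in>A. real (count_list (\<sigma> a) (from_nat_into B i)) * v a)"
      by (rule sum.reindex_bij_betw[OF eA])
    also have "\<dots> = 0"
      using 0 bij_betwE[OF eB] i by (simp add: poly_letter_poly_1)
    finally show "(?M *\<^sub>v ?v) $ i = 0\<^sub>v (card B) $ i" using i by simp
  qed (simp add: incidence_matrix_def)
  then have v0: "?v = 0\<^sub>v (card A)"
    using vec_space.full_column_rank_kernel[OF M _ vec_carrier] rank
    by (simp add: incidence_rank_def)
  obtain j where "j < card A" "a = from_nat_into A j"
    using a eA by (auto simp: bij_betw_def)
  then show "v a = 0" using arg_cong[OF v0, of "\<lambda>u. u $ j"] by simp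
qed

text \<open>Commuting words are powers of one word \<open>z\<close>, so all cuts are in phase and
  \<open>y\<close> repeats \<open>z\<close>.\<close>

lemma commuting_images_periodic:
  assumes T: "tiling {a, b} \<sigma> y T" and ne: "\<sigma> a \<noteq> []" "\<sigma> b \<noteq> []"
    and comm: "\<sigma> a @ \<sigma> b = \<sigma> b @ \<sigma> a"
  shows "periodic_point y"
proof -
  obtain m n z where z: "concat (replicate m z) = \<sigma> a" "concat (replicate n z) = \<sigma> b"
    using comm_append_are_replicate[OF comm] by blast
  define l where "l = length z"
  have nth: "concat (replicate i z) ! r = z ! (r mod l)" if "r < i * l" for i r
    using that
  proof (induction i arbitrary: r)
    case (Suc i)
    show ?case
    proof (cases "r < l")
      case False
      then have "r - l < i * l" using Suc.prems by auto
      then show ?thesis using Suc.IH False by (simp add: nth_append l_def le_mod_geq)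
    qed (simp add: nth_append l_def)
  qed simp
  have len: "length (concat (replicate i z)) = i * l" for i
    by (induction i) (auto simp: l_def)
  have \<sigma>: "l dvd length (\<sigma> c) \<and> (\<forall>r<length (\<sigma> c). \<sigma> c ! r = z ! (r mod l))" if "c \<in> {a, b}" for c
  proof -
    from that z obtain i where i: "\<sigma> c = concat (replicate i z)" by (metis insertE singletonD)
    show ?thesis unfolding i len using nth by simp
  qed
  have l: "1 \<le> l" using z ne by (cases z) (auto simp: l_def)
  have "y (p + int l) = y p" for p
  proof -
    obtain s c where t: "(s, c) \<in> T" "s \<le> p" "p < s + int (length (\<sigma> c))"
      using tiling_cover[OF T] by metis
    define r where "r = nat (p - s)"
    have r: "p = s + int r" "r < length (\<sigma> c)" using t by (auto simp: r_def)
    have c: "c \<in> {a, b}" using tilingD(1)[OF T t(1)] .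
    have yp: "y p = z ! (r mod l)" using tilingD(2)[OF T t(1) r(2)] r \<sigma>[OF c] by simp
    show ?thesis
    proof (cases "r + l < length (\<sigma> c)")
      case True
      then show ?thesis using tilingD(2)[OF T t(1) True] \<sigma>[OF c] r yp by (simp add: algebra_simps)
    next
      case False
      obtain c' where t': "(s + int (length (\<sigma> c)), c') \<in> T"
        using tiling_next[OF T _ t(1)] ne by auto
      have c': "c' \<in> {a, b}" using tilingD(1)[OF T t'] .
      let ?r = "r + l - length (\<sigma> c)"
      \<comment> \<open>A non-empty image is at least one copy of \<open>z\<close> long, so p + l
        falls into the next tile at the latest.\<close>
      have "l \<le> length (\<sigma> c')" using \<sigma>[OF c'] c' ne by (auto intro: dvd_imp_le)
      then have r': "?r < length (\<sigma> c')" using r(2) l by linarith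
      have "?r mod l = (?r + length (\<sigma> c)) mod l" using \<sigma>[OF c] by (auto elim!: dvdE)
      also have "\<dots> = r mod l" using False by simp
      finally have "y (s + int (length (\<sigma> c)) + int ?r) = y p"
        using tilingD(2)[OF T t' r'] \<sigma>[OF c'] r' yp by simp
      moreover have "s + int (length (\<sigma> c)) + int ?r = p + int l" using r False by linarith
      ultimately show ?thesis by simp
    qed
  qed
  then show ?thesis by (rule periodic_pointI[OF l])
qed

text \<open>Conjugation by the longest common prefix of \<open>uv\<close> and \<open>vu\<close>.\<close>

lemma noncommuting_words_conjugate:
  assumes "u @ v \<noteq> v @ u"
  obtains w u' v' where "u @ w = w @ u'" "v @ w = w @ v'" "u' \<noteq> []" "v' \<noteq> []" "hd u' \<noteq> hd v'"
proof -
  obtain w c \<alpha> d \<beta> where cd: "c \<noteq> d" "u @ v = w @ [c] @ \<alpha>" "v @ u = w @ [d] @ \<beta>"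
    using same_length_different[OF assms] by auto
  have ne: "u \<noteq> []" "v \<noteq> []" using assms by auto
  have *: "\<exists>u'. u @ w = w @ u' \<and> u' \<noteq> [] \<and> hd u' = c"
    if "u \<noteq> []" "u @ v = w @ [c] @ \<alpha>" "v @ u = w @ [d] @ \<beta>" for u v \<alpha> \<beta> and c d :: 'a
  proof -
    \<comment> \<open>Both sides are the word uvu. So \<open>w @ [c]\<close> and
      \<open>u @ w\<close> are prefixes of one word, and the shorter is a prefix of the
      longer.\<close>
    have "(u @ w) @ [d] @ \<beta> = (w @ [c]) @ \<alpha> @ u"
      using that(2,3) by (metis append.assoc)
    then have "prefix (w @ [c]) ((u @ w) @ [d] @ \<beta>)" by (rule prefixI)
    moreover have "prefix (u @ w) ((u @ w) @ [d] @ \<beta>)" by (rule prefixI[OF refl])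
    moreover have "length (w @ [c]) \<le> length (u @ w)" using that(1) by (cases u) auto
    ultimately have "prefix (w @ [c]) (u @ w)" by (rule prefix_length_prefix)
    then show ?thesis by (auto elim!: prefixE)
  qed
  obtain u' where u': "u @ w = w @ u'" "u' \<noteq> []" "hd u' = c" using *[OF ne(1) cd(2,3)] by blast
  obtain v' where v': "v @ w = w @ v'" "v' \<noteq> []" "hd v' = d" using *[OF ne(2) cd(3,2)] by blast
  show thesis using that u' v' cd(1) by blast
qed

lemma fully_recognizable_two_letters:
  assumes A: "card A = 2" and ne: "\<forall>a\<in>A. \<sigma> a \<noteq> []"
  shows "fully_recognizable A \<sigma>"
proof -
  obtain a b where ab: "A = {a, b}" "a \<noteq> b" using A by (auto simp: card_2_iff)
  show ?thesis
  proof (cases "\<sigma> a @ \<sigma> b = \<sigma> b @ \<sigma> a")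
    case True
    then show ?thesis
      using commuting_images_periodic[of a b \<sigma>] ne
      by (auto simp: ab fully_recognizable_def aperiodic_point_def)
  next
    case False
    obtain w u v where uv: "\<sigma> a @ w = w @ u" "\<sigma> b @ w = w @ v" "u \<noteq> []" "v \<noteq> []" "hd u \<noteq> hd v"
      using noncommuting_words_conjugate[OF False] by metis
    define \<tau> where "\<tau> c = (if c = a then u else v)" for c
    have "fully_recognizable A \<tau>"
      using uv ab by (intro fully_recognizable_left_permutative) (auto simp: \<tau>_def left_permutative_def)
    then show ?thesis
      using uv ab ne by (intro fully_recognizable_conjugate[of A \<tau> \<sigma> w]) (auto simp: \<tau>_def)
  qed
qed

theorem theorem4p6:
  fixes A :: "nat \<Rightarrow> 'a set" and \<sigma> :: "nat \<Rightarrow> 'a \<Rightarrow> 'a list"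
  assumes "\<And>n. finite (A n)"
    and "\<And>n. is_morphism (A (Suc n)) (A n) (\<sigma> n)"
    and "\<And>n. incidence_rank (A (Suc n)) (A n) (\<sigma> n) = card (A (Suc n))
           \<or> card (A (Suc n)) = 2
           \<or> left_permutative (A (Suc n)) (\<sigma> n)
           \<or> right_permutative (A (Suc n)) (\<sigma> n)
           \<or> (\<exists>\<tau>. is_morphism (A (Suc n)) (A n) \<tau>
                \<and> rotationally_conjugate (A (Suc n)) (A n) (\<sigma> n) \<tau>
                \<and> (left_permutative (A (Suc n)) \<tau> \<or> right_permutative (A (Suc n)) \<tau>))"
  shows "recognizable_aperiodic A \<sigma>"
proof -
  have ne: "\<forall>a\<in>A (Suc n). \<sigma> n a \<noteq> []" for n using assms(2) by (simp add: is_morphism_def)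
  have perm: "fully_recognizable (A (Suc n)) \<tau>"
    if "is_morphism (A (Suc n)) (A n) \<tau>"
      "left_permutative (A (Suc n)) \<tau> \<or> right_permutative (A (Suc n)) \<tau>" for n \<tau>
    using that fully_recognizable_left_permutative[OF assms(1), where \<sigma> = \<tau>]
      fully_recognizable_right_permutative[OF assms(1), where \<sigma> = \<tau>]
    unfolding is_morphism_def by blast
  have "fully_recognizable (A (Suc n)) (\<sigma> n)" for n
    using assms(3)[of n] fully_recognizable_full_rank[OF assms(1) assms(1) ne]
      fully_recognizable_two_letters[OF _ ne] perm[OF assms(2)] perm
      fully_recognizable_rotationally_conjugate[OF _ ne] by metis
  then show ?thesis
    unfolding recognizable_aperiodic_def Uniq_def
    using fully_recognizable_representation[OF ne] by blast
qed

end
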